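(* Let $\Psi$ be a general preference and let $\alpha$ be a trajectory with maximal weight with respect to $w_\Psi$ (i.e. $w_\Psi(\alpha)\ge w_\Psi(\beta)$ for every trajectory $\beta$). Then $\alpha$ is a most preferred trajectory with respect to $\Psi$, i.e. there is no trajectory $\beta$ with $\beta\prec_\Psi\alpha$.
   Context: A trajectory is a finite alternating sequence $s_0a_1s_1\ldots a_ns_n$ ($n\ge0$) of states and actions with $s_{i+1}\in\Phi(a_{i+1},s_i)$, where $\Phi$ is the transition function of a fixed action theory; states are complete consistent sets of fluent literals satisfying the static laws of the theory. $\alpha[i]$ denotes $s_ia_{i+1}\ldots a_ns_n$. Basic desire formulas are built from fluent formulas (propositional formulas over fluents), $occ(a)$ ($a$ an action) and $\mathbf{goal}(\psi)$ ($\psi$ a fluent formula) by $\wedge,\vee,\neg,\mathbf{next},\mathbf{until},\mathbf{always},\mathbf{eventually}$. Satisfaction by $\alpha=s_0a_1\ldots a_ns_n$: $\mathbf{goal}(\psi)$ iff $s_n\models\psi$; fluent formula $\psi$ iff $s_0\models\psi$; $occ(a)$ iff $n\ge1$ and $a_1=a$; Boolean connectives as usual; $\mathbf{next}(\psi)$ iff $n\ge1$ and $\alpha[1]\models\psi$; $\mathbf{always}(\psi)$ iff $\alpha[i]\models\psi$ for all $0\le i\le n$; $\mathbf{eventually}(\psi)$ iff $\alpha[i]\models\psi$ for some $0\le i\le n$; $\mathbf{until}(\psi_1,\psi_2)$ iff for some $0\le i\le n$, $\alpha[i]\models\psi_2$ and $\alpha[j]\models\psi_1$ for all $0\le j<i$.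 For a basic desire $\varphi$: $\alpha\prec_\varphi\beta$ iff $\alpha\models\varphi$ and $\beta\not\models\varphi$; $\alpha\approx_\varphi\beta$ iff both or neither satisfy $\varphi$. An atomic preference is $\Psi=\varphi_1\lhd\cdots\lhd\varphi_n$ ($\varphi_i$ basic desires): $\alpha\approx_\Psi\beta$ iff $\alpha\approx_{\varphi_i}\beta$ for all $i$; $\alpha\prec_\Psi\beta$ iff for some $i$, $\alpha\approx_{\varphi_j}\beta$ for all $j<i$ and $\alpha\prec_{\varphi_i}\beta$. General preferences: atomic preferences; $\Psi_1\&\Psi_2$, $\Psi_1\mid\Psi_2$, $!\Psi_1$, and $\Psi_1\lhd\cdots\lhd\Psi_k$ for general preferences $\Psi_i$. The relations: for $\Psi_1\&\Psi_2$, $\alpha\prec\beta$ iff $\alpha\prec_{\Psi_1}\beta$ and $\alpha\prec_{\Psi_2}\beta$; for $\Psi_1\mid\Psi_2$, $\alpha\prec\beta$ iff ($\alpha\prec_{\Psi_1}\beta$ and $\alpha\approx_{\Psi_2}\beta$) or ($\alpha\prec_{\Psi_2}\beta$ and $\alpha\approx_{\Psi_1}\beta$) or ($\alpha\prec_{\Psi_1}\beta$ and $\alpha\prec_{\Psi_2}\beta$); in both cases $\alpha\approx\beta$ iff $\alpha\approx_{\Psi_1}\beta$ and $\alpha\approx_{\Psi_2}\beta$; for $!\Psi_1$, $\alpha\prec\beta$ iff $\beta\prec_{\Psi_1}\alpha$, and $\alpha\approx\beta$ iff $\alpha\approx_{\Psi_1}\beta$; for $\Psi_1\lhd\cdots\lhd\Psi_k$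 the same lexicographic definition as for atomic preferences. Weights: for a basic desire $\varphi$, $w_\varphi(\alpha)=1$ if $\alpha\models\varphi$ and $0$ otherwise. For an atomic preference $\psi=\varphi_1\lhd\cdots\lhd\varphi_k$, $w_\psi(\alpha)=\sum_{r=1}^k 2^{k-r}w_{\varphi_r}(\alpha)$. For general preferences: $w_{\Psi_1\&\Psi_2}(\alpha)=w_{\Psi_1\mid\Psi_2}(\alpha)=w_{\Psi_1}(\alpha)+w_{\Psi_2}(\alpha)$; $w_{!\Psi_1}(\alpha)=max(\Psi_1)-w_{\Psi_1}(\alpha)$; $w_{\Psi_1\lhd\Psi_2}(\alpha)=max(\Psi_2)\,w_{\Psi_1}(\alpha)+w_{\Psi_2}(\alpha)$, where $max(\Psi_i)$ is one plus the maximum weight $w_{\Psi_i}$ achieved by a trajectory. Chains of more than two (non-atomic) preferences are read as nested chains of length 2: $\Psi_1\lhd\Psi_2\lhd\Psi_3$ as $\Psi_1\lhd(\Psi_2\lhd\Psi_3)$, etc. *)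

theory Defs
  imports Main
begin

datatype 'f literal = Pos 'f | Neg 'f

type_synonym 'f state = "'f literal set"

text \<open>
  A static law is a pair \<open>(B, l)\<close>, read as ``whenever all literals of \<open>B\<close> hold, \<open>l\<close> holds''.
  No assumption is made on the way the transition function arises from the theory.
\<close>

record ('f, 'a) action_theory =
  static_laws :: "('f literal set \<times> 'f literal) set"
  transition :: "'a \<Rightarrow> 'f state \<Rightarrow> 'f state set"

definition complete_consistent :: "'f literal set \<Rightarrow> bool" where
  "complete_consistent s \<longleftrightarrow>
    (\<forall>f. Pos f \<in> s \<or> Neg f \<in> s) \<and> (\<forall>f. \<not> (Pos f \<in> s \<and> Neg f \<in> s))"

definition states :: "('f, 'a, 'm) action_theory_scheme \<Rightarrow> 'f state set" where
  "states D =
    {s. complete_consistent s \<and> (\<forall>(B, l) \<in> static_laws D. B \<subseteq> s \<longrightarrow> l \<in> s)}"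

text \<open>The sequence \<open>s\<^sub>0 a\<^sub>1 s\<^sub>1 \<dots> a\<^sub>n s\<^sub>n\<close> is encoded as \<open>(s\<^sub>0, [(a\<^sub>1, s\<^sub>1), \<dots>, (a\<^sub>n, s\<^sub>n)])\<close>.\<close>

type_synonym ('f, 'a) path = "'f state \<times> ('a \<times> 'f state) list"

definition path_length :: "('f, 'a) path \<Rightarrow> nat" where
  "path_length \<alpha> = length (snd \<alpha>)"

definition state_at :: "('f, 'a) path \<Rightarrow> nat \<Rightarrow> 'f state" where
  "state_at \<alpha> i = (if i = 0 then fst \<alpha> else snd (snd \<alpha> ! (i - 1)))"

text \<open>Actions are numbered from 1.\<close>

definition action_at :: "('f, 'a) path \<Rightarrow> nat \<Rightarrow> 'a" where
  "action_at \<alpha> i = fst (snd \<alpha> ! (i - 1))"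

definition path_from :: "('f, 'a) path \<Rightarrow> nat \<Rightarrow> ('f, 'a) path" where
  "path_from \<alpha> i = (state_at \<alpha> i, drop i (snd \<alpha>))"

definition trajectories :: "('f, 'a, 'm) action_theory_scheme \<Rightarrow> ('f, 'a) path set" where
  "trajectories D =
    {\<alpha>. (\<forall>i \<le> path_length \<alpha>. state_at \<alpha> i \<in> states D) \<and>
        (\<forall>i < path_length \<alpha>.
           state_at \<alpha> (i + 1) \<in> transition D (action_at \<alpha> (i + 1)) (state_at \<alpha> i))}"

datatype 'f fluent_formula =
    Fluent 'f
  | FNot "'f fluent_formula"
  | FAnd "'f fluent_formula" "'f fluent_formula"
  | FOr "'f fluent_formula" "'f fluent_formula"

primrec holds :: "'f fluent_formula \<Rightarrow> 'f state \<Rightarrow> bool" where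
  "holds (Fluent f) s \<longleftrightarrow> Pos f \<in> s"
| "holds (FNot \<psi>) s \<longleftrightarrow> \<not> holds \<psi> s"
| "holds (FAnd \<psi>\<^sub>1 \<psi>\<^sub>2) s \<longleftrightarrow> holds \<psi>\<^sub>1 s \<and> holds \<psi>\<^sub>2 s"
| "holds (FOr \<psi>\<^sub>1 \<psi>\<^sub>2) s \<longleftrightarrow> holds \<psi>\<^sub>1 s \<or> holds \<psi>\<^sub>2 s"

datatype ('f, 'a) desire =
    Now "'f fluent_formula"
  | Occ 'a
  | Goal "'f fluent_formula"
  | DAnd "('f, 'a) desire" "('f, 'a) desire"
  | DOr "('f, 'a) desire" "('f, 'a) desire"
  | DNot "('f, 'a) desire"
  | Next "('f, 'a) desire"
  | Until "('f, 'a) desire" "('f, 'a) desire"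
  | Always "('f, 'a) desire"
  | Eventually "('f, 'a) desire"

primrec satisfies :: "('f, 'a) desire \<Rightarrow> ('f, 'a) path \<Rightarrow> bool" where
  "satisfies (Now \<psi>) \<alpha> \<longleftrightarrow> holds \<psi> (state_at \<alpha> 0)"
| "satisfies (Occ a) \<alpha> \<longleftrightarrow> path_length \<alpha> \<ge> 1 \<and> action_at \<alpha> 1 = a"
| "satisfies (Goal \<psi>) \<alpha> \<longleftrightarrow> holds \<psi> (state_at \<alpha> (path_length \<alpha>))"
| "satisfies (DAnd \<phi>\<^sub>1 \<phi>\<^sub>2) \<alpha> \<longleftrightarrow> satisfies \<phi>\<^sub>1 \<alpha> \<and> satisfies \<phi>\<^sub>2 \<alpha>"
| "satisfies (DOr \<phi>\<^sub>1 \<phi>\<^sub>2) \<alpha> \<longleftrightarrow> satisfies \<phi>\<^sub>1 \<alpha> \<or> satisfies \<phi>\<^sub>2 \<alpha>"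
| "satisfies (DNot \<phi>) \<alpha> \<longleftrightarrow> \<not> satisfies \<phi> \<alpha>"
| "satisfies (Next \<phi>) \<alpha> \<longleftrightarrow> path_length \<alpha> \<ge> 1 \<and> satisfies \<phi> (path_from \<alpha> 1)"
| "satisfies (Until \<phi>\<^sub>1 \<phi>\<^sub>2) \<alpha> \<longleftrightarrow>
    (\<exists>i \<le> path_length \<alpha>. satisfies \<phi>\<^sub>2 (path_from \<alpha> i) \<and> (\<forall>j < i. satisfies \<phi>\<^sub>1 (path_from \<alpha> j)))"
| "satisfies (Always \<phi>) \<alpha> \<longleftrightarrow> (\<forall>i \<le> path_length \<alpha>. satisfies \<phi> (path_from \<alpha> i))"
| "satisfies (Eventually \<phi>) \<alpha> \<longleftrightarrow> (\<exists>i \<le> path_length \<alpha>. satisfies \<phi> (path_from \<alpha> i))"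

definition desire_prefers :: "('f, 'a) desire \<Rightarrow> ('f, 'a) path \<Rightarrow> ('f, 'a) path \<Rightarrow> bool" where
  "desire_prefers \<phi> \<alpha> \<beta> \<longleftrightarrow> satisfies \<phi> \<alpha> \<and> \<not> satisfies \<phi> \<beta>"

definition desire_indiff :: "('f, 'a) desire \<Rightarrow> ('f, 'a) path \<Rightarrow> ('f, 'a) path \<Rightarrow> bool" where
  "desire_indiff \<phi> \<alpha> \<beta> \<longleftrightarrow> (satisfies \<phi> \<alpha> \<longleftrightarrow> satisfies \<phi> \<beta>)"

datatype ('f, 'a) preference =
    Atomic "('f, 'a) desire list"
  | PAnd "('f, 'a) preference" "('f, 'a) preference"
  | POr "('f, 'a) preference" "('f, 'a) preference"
  | PRev "('f, 'a) preference"
  | Chain "('f, 'a) preference list"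

text \<open>Well-formedness: all chains are nonempty.\<close>

primrec general_preference :: "('f, 'a) preference \<Rightarrow> bool" where
  "general_preference (Atomic \<phi>s) \<longleftrightarrow> \<phi>s \<noteq> []"
| "general_preference (PAnd \<Psi>\<^sub>1 \<Psi>\<^sub>2) \<longleftrightarrow> general_preference \<Psi>\<^sub>1 \<and> general_preference \<Psi>\<^sub>2"
| "general_preference (POr \<Psi>\<^sub>1 \<Psi>\<^sub>2) \<longleftrightarrow> general_preference \<Psi>\<^sub>1 \<and> general_preference \<Psi>\<^sub>2"
| "general_preference (PRev \<Psi>) \<longleftrightarrow> general_preference \<Psi>"
| "general_preference (Chain \<Psi>s) \<longleftrightarrow> \<Psi>s \<noteq> [] \<and> list_all general_preference \<Psi>s"

text \<open>
  The lexicographic combination of a list of indifference relations \<open>E\<close> and a list (of the same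
  length) of strict preferences \<open>P\<close>; list positions are numbered from 0.
\<close>

definition lex_indiff :: "('p \<Rightarrow> 'p \<Rightarrow> bool) list \<Rightarrow> 'p \<Rightarrow> 'p \<Rightarrow> bool" where
  "lex_indiff E \<alpha> \<beta> \<longleftrightarrow> (\<forall>i < length E. (E ! i) \<alpha> \<beta>)"

definition lex_prefers ::
    "('p \<Rightarrow> 'p \<Rightarrow> bool) list \<Rightarrow> ('p \<Rightarrow> 'p \<Rightarrow> bool) list \<Rightarrow> 'p \<Rightarrow> 'p \<Rightarrow> bool" where
  "lex_prefers E P \<alpha> \<beta> \<longleftrightarrow> (\<exists>i < length P. (\<forall>j < i. (E ! j) \<alpha> \<beta>) \<and> (P ! i) \<alpha> \<beta>)"

primrec indiff :: "('f, 'a) preference \<Rightarrow> ('f, 'a) path \<Rightarrow> ('f, 'a) path \<Rightarrow> bool" where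
  "indiff (Atomic \<phi>s) = lex_indiff (map desire_indiff \<phi>s)"
| "indiff (PAnd \<Psi>\<^sub>1 \<Psi>\<^sub>2) = (\<lambda>\<alpha> \<beta>. indiff \<Psi>\<^sub>1 \<alpha> \<beta> \<and> indiff \<Psi>\<^sub>2 \<alpha> \<beta>)"
| "indiff (POr \<Psi>\<^sub>1 \<Psi>\<^sub>2) = (\<lambda>\<alpha> \<beta>. indiff \<Psi>\<^sub>1 \<alpha> \<beta> \<and> indiff \<Psi>\<^sub>2 \<alpha> \<beta>)"
| "indiff (PRev \<Psi>) = (\<lambda>\<alpha> \<beta>. indiff \<Psi> \<alpha> \<beta>)"
| "indiff (Chain \<Psi>s) = lex_indiff (map indiff \<Psi>s)"

text \<open>\<open>prefers \<Psi> \<alpha> \<beta>\<close> is \<open>\<alpha> \<prec>\<^sub>\<Psi> \<beta>\<close>: the first argument is the better one.\<close>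

primrec prefers :: "('f, 'a) preference \<Rightarrow> ('f, 'a) path \<Rightarrow> ('f, 'a) path \<Rightarrow> bool" where
  "prefers (Atomic \<phi>s) = lex_prefers (map desire_indiff \<phi>s) (map desire_prefers \<phi>s)"
| "prefers (PAnd \<Psi>\<^sub>1 \<Psi>\<^sub>2) = (\<lambda>\<alpha> \<beta>. prefers \<Psi>\<^sub>1 \<alpha> \<beta> \<and> prefers \<Psi>\<^sub>2 \<alpha> \<beta>)"
| "prefers (POr \<Psi>\<^sub>1 \<Psi>\<^sub>2) = (\<lambda>\<alpha> \<beta>.
    (prefers \<Psi>\<^sub>1 \<alpha> \<beta> \<and> indiff \<Psi>\<^sub>2 \<alpha> \<beta>) \<or>
    (prefers \<Psi>\<^sub>2 \<alpha> \<beta> \<and> indiff \<Psi>\<^sub>1 \<alpha> \<beta>) \<or>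
    (prefers \<Psi>\<^sub>1 \<alpha> \<beta> \<and> prefers \<Psi>\<^sub>2 \<alpha> \<beta>))"
| "prefers (PRev \<Psi>) = (\<lambda>\<alpha> \<beta>. prefers \<Psi> \<beta> \<alpha>)"
| "prefers (Chain \<Psi>s) = lex_prefers (map indiff \<Psi>s) (map prefers \<Psi>s)"

definition most_preferred ::
    "('f, 'a, 'm) action_theory_scheme \<Rightarrow> ('f, 'a) preference \<Rightarrow> ('f, 'a) path \<Rightarrow> bool" where
  "most_preferred D \<Psi> \<alpha> \<longleftrightarrow>
    \<alpha> \<in> trajectories D \<and> \<not> (\<exists>\<beta> \<in> trajectories D. prefers \<Psi> \<beta> \<alpha>)"

definition desire_weight :: "('f, 'a) desire \<Rightarrow> ('f, 'a) path \<Rightarrow> int" where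
  "desire_weight \<phi> \<alpha> = (if satisfies \<phi> \<alpha> then 1 else 0)"

text \<open>
  The bound \<open>max(\<Psi>)\<close>, as a function of the weight function \<open>w\<close> of \<open>\<Psi>\<close>. The weight function of a
  preference takes only finitely many values, so the maximum exists as soon as there is a trajectory.
\<close>

definition weight_bound ::
    "('f, 'a, 'm) action_theory_scheme \<Rightarrow> (('f, 'a) path \<Rightarrow> int) \<Rightarrow> int" where
  "weight_bound D w = 1 + Max (w ` trajectories D)"

text \<open>
  Weight of a chain \<open>\<Psi>\<^sub>1 \<lhd> \<Psi>\<^sub>2 \<lhd> \<dots> \<lhd> \<Psi>\<^sub>k\<close>, read as \<open>\<Psi>\<^sub>1 \<lhd> (\<Psi>\<^sub>2 \<lhd> (\<dots> \<lhd> \<Psi>\<^sub>k))\<close>, in terms of the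
  weight functions of the \<open>\<Psi>\<^sub>i\<close>.
\<close>

fun chain_weight ::
    "('f, 'a, 'm) action_theory_scheme \<Rightarrow> (('f, 'a) path \<Rightarrow> int) list \<Rightarrow> ('f, 'a) path \<Rightarrow> int" where
  "chain_weight D [] = (\<lambda>\<alpha>. 0)"
| "chain_weight D [w] = w"
| "chain_weight D (w # v # ws) =
    (\<lambda>\<alpha>. weight_bound D (chain_weight D (v # ws)) * w \<alpha> + chain_weight D (v # ws) \<alpha>)"

primrec weight ::
    "('f, 'a, 'm) action_theory_scheme \<Rightarrow> ('f, 'a) preference \<Rightarrow> ('f, 'a) path \<Rightarrow> int" where
  "weight D (Atomic \<phi>s) =
    (\<lambda>\<alpha>. \<Sum>r = 1..length \<phi>s. 2 ^ (length \<phi>s - r) * desire_weight (\<phi>s ! (r - 1)) \<alpha>)"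
| "weight D (PAnd \<Psi>\<^sub>1 \<Psi>\<^sub>2) = (\<lambda>\<alpha>. weight D \<Psi>\<^sub>1 \<alpha> + weight D \<Psi>\<^sub>2 \<alpha>)"
| "weight D (POr \<Psi>\<^sub>1 \<Psi>\<^sub>2) = (\<lambda>\<alpha>. weight D \<Psi>\<^sub>1 \<alpha> + weight D \<Psi>\<^sub>2 \<alpha>)"
| "weight D (PRev \<Psi>) = (\<lambda>\<alpha>. weight_bound D (weight D \<Psi>) - weight D \<Psi> \<alpha>)"
| "weight D (Chain \<Psi>s) = chain_weight D (map (weight D) \<Psi>s)"

end

theory Submission
  imports Defs
begin

text \<open>
  By induction on the preference, its weight function is a nonnegative, finitely valued function
  that is strictly monotone for \<open>\<prec>\<close> and invariant under \<open>\<approx>\<close>. In a chain, the head weight is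
  multiplied by a number exceeding every weight of the tail, so one unit gained in the head
  outweighs any loss in the tail. Atomic preferences are the same situation in base 2.
\<close>

lemma lex_indiff_Nil [simp]: "lex_indiff [] \<alpha> \<beta>"
  by (simp add: lex_indiff_def)

lemma lex_indiff_Cons [simp]: "lex_indiff (e # E) \<alpha> \<beta> \<longleftrightarrow> e \<alpha> \<beta> \<and> lex_indiff E \<alpha> \<beta>"
  by (auto simp: lex_indiff_def All_less_Suc2)

lemma lex_prefers_Nil [simp]: "\<not> lex_prefers E [] \<alpha> \<beta>"
  by (simp add: lex_prefers_def)

lemma lex_prefers_Cons [simp]:
  "lex_prefers (e # E) (p # P) \<alpha> \<beta> \<longleftrightarrow> p \<alpha> \<beta> \<or> e \<alpha> \<beta> \<and> lex_prefers E P \<alpha> \<beta>"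
  by (auto simp: lex_prefers_def Ex_less_Suc2 All_less_Suc2)

text \<open>Finiteness makes the \<open>Max\<close> inside \<open>weight_bound\<close> a genuine
  maximum; nonnegativity keeps a tail from undoing a gain in the head. Only implications are asked
  for, since trajectories incomparable under \<open>PAnd\<close> may differ in weight.\<close>

definition represents ::
    "'p set \<Rightarrow> ('p \<Rightarrow> int) \<Rightarrow> ('p \<Rightarrow> 'p \<Rightarrow> bool) \<Rightarrow> ('p \<Rightarrow> 'p \<Rightarrow> bool) \<Rightarrow> bool" where
  "represents T w E P \<longleftrightarrow> finite (w ` T) \<and> (\<forall>\<alpha> \<in> T. 0 \<le> w \<alpha>) \<and>
    (\<forall>\<alpha> \<in> T. \<forall>\<beta> \<in> T. (E \<alpha> \<beta> \<longrightarrow> w \<alpha> = w \<beta>) \<and> (P \<alpha> \<beta> \<longrightarrow> w \<beta> < w \<alpha>))"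

lemma finite_image_binary:
  assumes "finite (f ` T)" and "finite (g ` T)"
  shows "finite ((\<lambda>x. h (f x) (g x)) ` T)"
proof (rule finite_subset)
  show "(\<lambda>x. h (f x) (g x)) ` T \<subseteq> case_prod h ` (f ` T \<times> g ` T)"
    by auto
qed (use assms in auto)

text \<open>The common step for atomic preferences and nested chains: \<open>B\<close> may be any
  strict upper bound of the tail weight \<open>v\<close> on \<open>T\<close>.\<close>

lemma represents_lex_Cons:
  assumes w: "represents T w e p" and v: "represents T v (lex_indiff E) (lex_prefers E P)"
    and bound: "\<And>\<alpha>. \<alpha> \<in> T \<Longrightarrow> v \<alpha> < B"
  shows "represents T (\<lambda>\<alpha>. B * w \<alpha> + v \<alpha>) (lex_indiff (e # E)) (lex_prefers (e # E) (p # P))"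
proof -
  \<comment> \<open>This follows from 0 \<le> \<open>v \<alpha>\<close> < \<open>B\<close>, so a
    member of \<open>T\<close> is required.\<close>
  have pos: "0 < B" if "\<alpha> \<in> T" for \<alpha>
    using that bound v by (force simp: represents_def)
  have head: "B * w \<beta> + v \<beta> < B * w \<alpha> + v \<alpha>"
    if "\<alpha> \<in> T" "\<beta> \<in> T" "w \<beta> < w \<alpha>" for \<alpha> \<beta>
  proof -
    \<comment> \<open>Weights are integers, so a strictly larger head weight is larger by at least 1
      and contributes at least \<open>B\<close> more.\<close>
    have "B * (w \<beta> + 1) \<le> B * w \<alpha>"
      using that(3) pos[OF that(1)] by (intro mult_left_mono) auto
    moreover have "v \<beta> < B" "0 \<le> v \<alpha>"
      using that bound v by (auto simp: represents_def)
    ultimately show ?thesis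
      by (simp add: distrib_left)
  qed
  have "finite ((\<lambda>\<alpha>. B * w \<alpha> + v \<alpha>) ` T)"
    using w v finite_image_binary[where h = "\<lambda>x y. B * x + y"] by (auto simp: represents_def)
  moreover have "0 \<le> B * w \<alpha> + v \<alpha>" if "\<alpha> \<in> T" for \<alpha>
    using that w v pos[OF that] by (simp add: represents_def)
  ultimately show ?thesis
    using w v head by (auto simp: represents_def)
qed

lemma less_weight_bound:
  assumes "represents (trajectories D) w E P" and "\<alpha> \<in> trajectories D"
  shows "w \<alpha> < weight_bound D w"
proof -
  have "w \<alpha> \<le> Max (w ` trajectories D)"
    using assms by (intro Max_ge) (auto simp: represents_def)
  then show ?thesis
    by (simp add: weight_bound_def)
qed

lemma represents_desire: "represents T (desire_weight \<phi>) (desire_indiff \<phi>) (desire_prefers \<phi>)"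
proof -
  have "desire_weight \<phi> ` T \<subseteq> {0, 1}"
    by (auto simp: desire_weight_def)
  then have "finite (desire_weight \<phi> ` T)"
    by (rule finite_subset) simp
  then show ?thesis
    by (auto simp: represents_def desire_weight_def desire_indiff_def desire_prefers_def)
qed

text \<open>The summand r = 1 splits off with exponent \<open>length \<phi>s\<close>; shifting the
  index in the rest leaves the weight of \<open>\<phi>s\<close>.\<close>

lemma weight_Atomic_Cons:
  "weight D (Atomic (\<phi> # \<phi>s)) =
    (\<lambda>\<alpha>. 2 ^ length \<phi>s * desire_weight \<phi> \<alpha> + weight D (Atomic \<phi>s) \<alpha>)"
proof
  fix \<alpha>
  have "(\<Sum>r = Suc 1..Suc (length \<phi>s).
          2 ^ (Suc (length \<phi>s) - r) * desire_weight ((\<phi> # \<phi>s) ! (r - 1)) \<alpha>) =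
        (\<Sum>r = 1..length \<phi>s. 2 ^ (length \<phi>s - r) * desire_weight (\<phi>s ! (r - 1)) \<alpha>)"
    unfolding sum.shift_bounds_cl_Suc_ivl by (rule sum.cong) (auto simp: nth_Cons')
  then show "weight D (Atomic (\<phi> # \<phi>s)) \<alpha> =
      2 ^ length \<phi>s * desire_weight \<phi> \<alpha> + weight D (Atomic \<phi>s) \<alpha>"
    using sum.atLeast_Suc_atMost[of 1 "Suc (length \<phi>s)"
        "\<lambda>r. 2 ^ (Suc (length \<phi>s) - r) * desire_weight ((\<phi> # \<phi>s) ! (r - 1)) \<alpha>"]
    by simp
qed

text \<open>The weight is the value of a binary numeral with \<open>length \<phi>s\<close>
  digits.\<close>

lemma weight_Atomic_less: "weight D (Atomic \<phi>s) \<alpha> < 2 ^ length \<phi>s"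
proof (induction \<phi>s)
  case (Cons \<phi> \<phi>s)
  moreover have "2 ^ length \<phi>s * desire_weight \<phi> \<alpha> \<le> 2 ^ length \<phi>s"
    by (simp add: desire_weight_def)
  ultimately show ?case
    unfolding weight_Atomic_Cons length_Cons power_Suc by linarith
qed simp

lemma represents_Atomic:
  "represents T (weight D (Atomic \<phi>s)) (indiff (Atomic \<phi>s)) (prefers (Atomic \<phi>s))"
proof (induction \<phi>s)
  case Nil
  then show ?case
    by (simp add: represents_def image_constant_conv)
next
  case (Cons \<phi> \<phi>s)
  show ?case
    using represents_lex_Cons[OF represents_desire Cons[unfolded indiff.simps prefers.simps]
        weight_Atomic_less]
    unfolding weight_Atomic_Cons indiff.simps prefers.simps list.map .
qed

text \<open>The induction follows the recursion of \<open>chain_weight\<close>: a singleton keeps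
  its weight unscaled, and each further head is scaled by the bound of the whole remaining
  chain.\<close>

lemma represents_chain:
  assumes "\<And>\<Psi>. \<Psi> \<in> set \<Psi>s \<Longrightarrow> represents (trajectories D) (w \<Psi>) (E \<Psi>) (P \<Psi>)"
  shows "represents (trajectories D) (chain_weight D (map w \<Psi>s))
    (lex_indiff (map E \<Psi>s)) (lex_prefers (map E \<Psi>s) (map P \<Psi>s))"
  using assms
proof (induction \<Psi>s rule: induct_list012)
  case 1
  then show ?case
    by (simp add: represents_def image_constant_conv)
next
  case (2 \<Psi>)
  then show ?case
    by (simp add: represents_def)
next
  case (3 \<Psi> \<Psi>' \<Psi>s)
  have head: "represents (trajectories D) (w \<Psi>) (E \<Psi>) (P \<Psi>)"
    using 3 by simp
  have tail: "represents (trajectories D) (chain_weight D (map w (\<Psi>' # \<Psi>s)))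
      (lex_indiff (map E (\<Psi>' # \<Psi>s))) (lex_prefers (map E (\<Psi>' # \<Psi>s)) (map P (\<Psi>' # \<Psi>s)))"
    by (rule "3.IH") (use "3.prems" in auto)
  show ?case
    using represents_lex_Cons[OF head tail less_weight_bound[OF tail]]
    unfolding list.map chain_weight.simps .
qed

text \<open>In each disjunct one summand strictly grows and the other does not drop. Asking only for
  implications from \<open>E\<close> and \<open>P\<close> covers \<open>PAnd\<close> and
  \<open>POr\<close> at once.\<close>

lemma represents_add:
  assumes "represents T w\<^sub>1 E\<^sub>1 P\<^sub>1" and "represents T w\<^sub>2 E\<^sub>2 P\<^sub>2"
    and "\<And>\<alpha> \<beta>. E \<alpha> \<beta> \<Longrightarrow> E\<^sub>1 \<alpha> \<beta> \<and> E\<^sub>2 \<alpha> \<beta>"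
    and "\<And>\<alpha> \<beta>. P \<alpha> \<beta> \<Longrightarrow>
      P\<^sub>1 \<alpha> \<beta> \<and> E\<^sub>2 \<alpha> \<beta> \<or> P\<^sub>2 \<alpha> \<beta> \<and> E\<^sub>1 \<alpha> \<beta> \<or> P\<^sub>1 \<alpha> \<beta> \<and> P\<^sub>2 \<alpha> \<beta>"
  shows "represents T (\<lambda>\<alpha>. w\<^sub>1 \<alpha> + w\<^sub>2 \<alpha>) E P"
proof -
  have "finite ((\<lambda>\<alpha>. w\<^sub>1 \<alpha> + w\<^sub>2 \<alpha>) ` T)"
    using assms(1,2) by (simp add: represents_def finite_image_binary[where h = "(+)"])
  then show ?thesis
    using assms unfolding represents_def by (smt (verit))
qed

text \<open>Subtracting from an upper bound reverses strict inequalities, preserves equalities and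
  keeps the values nonnegative.\<close>

lemma represents_reverse:
  assumes w: "represents T w E P" and bound: "\<And>\<alpha>. \<alpha> \<in> T \<Longrightarrow> w \<alpha> < B"
  shows "represents T (\<lambda>\<alpha>. B - w \<alpha>) E (\<lambda>\<alpha> \<beta>. P \<beta> \<alpha>)"
proof -
  have "finite ((\<lambda>x. B - x) ` w ` T)"
    using w by (simp add: represents_def)
  then have "finite ((\<lambda>\<alpha>. B - w \<alpha>) ` T)"
    by (simp add: image_image)
  then show ?thesis
    using w bound by (auto simp: represents_def less_imp_le)
qed

theorem represents_weight:
  "represents (trajectories D) (weight D \<Psi>) (indiff \<Psi>) (prefers \<Psi>)"
proof (induction \<Psi>)
  case (Atomic \<phi>s)
  show ?case
    by (rule represents_Atomic)
next
  case (PAnd \<Psi>\<^sub>1 \<Psi>\<^sub>2)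
  then show ?case
    unfolding weight.simps by (rule represents_add) auto
next
  case (POr \<Psi>\<^sub>1 \<Psi>\<^sub>2)
  then show ?case
    unfolding weight.simps by (rule represents_add) auto
next
  case (PRev \<Psi>)
  then show ?case
    using represents_reverse[OF PRev less_weight_bound[OF PRev]] by simp
next
  case (Chain \<Psi>s)
  then show ?case
    unfolding weight.simps indiff.simps prefers.simps by (rule represents_chain)
qed

theorem proposition10:
  fixes D :: "('f, 'a) action_theory"
    and \<Psi> :: "('f, 'a) preference"
    and \<alpha> :: "('f, 'a) path"
  assumes "general_preference \<Psi>"
    and "\<alpha> \<in> trajectories D"
    and "\<forall>\<beta> \<in> trajectories D. weight D \<Psi> \<alpha> \<ge> weight D \<Psi> \<beta>"
  shows "most_preferred D \<Psi> \<alpha>"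
  \<comment> \<open>A trajectory preferred to \<alpha> would have strictly larger weight, against
    maximality.\<close>
  using represents_weight[of D \<Psi>] assms(2,3)
  unfolding most_preferred_def represents_def by (meson leD)

end
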